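(* With the circles $\mathbf{S}^1_{\mathrm{I}},\mathbf{S}^1_{\mathrm{II}},\mathbf{S}^1_{\mathrm{III}}$ and the Lagrange spectra $\mathscr{L}(\mathcal X,\mathcal Z)$ defined in the context, $$\mathscr{L}(\mathbf S^1_{\mathrm{I}},\mathbf S^1_{\mathrm{I}}\cap\mathbb{Q}^2)=\tfrac1{\sqrt2}\,\mathscr{L}(\mathbb{R},\sqrt2\,\mathbb{Q}),$$ $$\mathscr{L}(\mathbf S^1_{\mathrm{II}},\mathbf S^1_{\mathrm{II}}\cap\mathbb{Q}^2)=\tfrac12\,\mathscr{L}(\mathbb{R},\sqrt2\,\mathbb{Q}),$$ $$\mathscr{L}(\mathbf S^1_{\mathrm{III}},\mathbf S^1_{\mathrm{III}}\cap\mathbb{Q}^3)=\tfrac1{\sqrt2}\,\mathscr{L}(\mathbb{R},\mathbb{Q}).$$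
   Context: Lagrange numbers and spectra. Let $(\mathcal X,\mathrm d)$ be a complete metric space, $\mathcal Z\subset\mathcal X$ a countable dense subset, and $\mathrm{Ht}_{\mathcal Z}:\mathcal Z\to\mathbb{R}_{\ge0}$ a height function. For $P\in\mathcal X\setminus\mathcal Z$, $$L_{(\mathcal X,\mathcal Z)}(P)=\limsup_{Z\in\mathcal Z}\frac{1}{\mathrm{Ht}_{\mathcal Z}(Z)\,\mathrm d(P,Z)}\in[0,\infty],$$ where the limsup over the countable set $\mathcal Z$ is $\inf_{F\subset\mathcal Z\text{ finite}}\ \sup_{Z\in\mathcal Z\setminus F}$ (equivalently, the supremum of those $L\ge 0$ for which $\mathrm d(P,Z)<1/(L\,\mathrm{Ht}_{\mathcal Z}(Z))$ has infinitely many solutions $Z\in\mathcal Z$). The Lagrange spectrum is $$\mathscr{L}(\mathcal X,\mathcal Z)=\{L_{(\mathcal X,\mathcal Z)}(P): P\in\mathcal X\setminus\mathcal Z,\ L_{(\mathcal X,\mathcal Z)}(P)>0\}.$$ For $c>0$ and a set $A$, $cA=\{ca:a\in A\}$ (with $c\cdot\infty=\infty$). Circles. $\mathbf{S}^1_{\mathrm{I}}=\{(x_1,x_2)\in\mathbb{R}^2: x_1^2+x_2^2=1\}$; $\mathbf{S}^1_{\mathrm{II}}=\{(x_1,x_2)\in\mathbb{R}^2: x_1^2+x_2^2=2\}$; $\mathbf{S}^1_{\mathrm{III}}=\{(x_0,x_1,x_2)\in\mathbb{R}^3: x_0+x_1+x_2=1,\ x_0^2+x_1^2+x_2^2=1\}$.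 The distance on each is the Euclidean distance of the ambient $\mathbb{R}^l$ ($l=2,2,3$). The height of a rational point is $\mathrm{Ht}(\mathbf p/q)=|q|$, where $\mathbf p\in\mathbb{Z}^l$ is primitive (its coordinates have no common divisor $>1$) and $q$ is a nonzero integer (on these circles this is equivalent to requiring that the coordinates of $\mathbf p$ together with $q$ have gcd $1$). Real line. The distance on $\mathbb{R}$ is $|x-y|$. On $\mathbb{Q}$: $\mathrm{Ht}_{\mathbb{Q}}(p/q)=q^2$ for a reduced fraction $p/q$. On $\sqrt2\,\mathbb{Q}=\{\sqrt2 t: t\in\mathbb{Q}\}$: every $r\in\sqrt2\,\mathbb{Q}$ can be written uniquely up to signs with coprime integers $p,q$ either as $r=\sqrt2\,p/q$ with $q$ odd, or as $r=p/(\sqrt2\,q)$ with $p$ odd; set $\mathrm{Ht}_{\sqrt2\mathbb{Q}}(r)=q^2$ in the first case and $\mathrm{Ht}_{\sqrt2\mathbb{Q}}(r)=2q^2$ in the second. *)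

theory Defs
  imports "HOL-Analysis.Analysis"
begin

text \<open>
  The space is a subset \<open>X\<close> of a metric type, with the induced distance; \<open>Z\<close> is the countable
  dense subset and \<open>ht\<close> is only evaluated on \<open>Z\<close>.  The limit superior is taken along the
  complements of finite subsets of \<open>Z\<close>.
\<close>

definition lagrange_number ::
  "'a::metric_space set \<Rightarrow> ('a \<Rightarrow> real) \<Rightarrow> 'a \<Rightarrow> ennreal" where
  "lagrange_number Z ht P =
     (INF F\<in>{F. F \<subseteq> Z \<and> finite F}. SUP z\<in>Z - F. 1 / ennreal (ht z * dist P z))"

definition lagrange_spectrum ::
  "'a::metric_space set \<Rightarrow> 'a set \<Rightarrow> ('a \<Rightarrow> real) \<Rightarrow> ennreal set" where
  "lagrange_spectrum X Z ht =
     {lagrange_number Z ht P |P. P \<in> X - Z \<and> lagrange_number Z ht P > 0}"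

definition circle_I :: "(real ^ 2) set" where
  "circle_I = {x. (x $ 1)\<^sup>2 + (x $ 2)\<^sup>2 = 1}"

definition circle_II :: "(real ^ 2) set" where
  "circle_II = {x. (x $ 1)\<^sup>2 + (x $ 2)\<^sup>2 = 2}"

text \<open>The coordinates \<open>x\<^sub>0, x\<^sub>1, x\<^sub>2\<close> are the components \<open>x $ 1, x $ 2, x $ 3\<close>.\<close>

definition circle_III :: "(real ^ 3) set" where
  "circle_III = {x. x $ 1 + x $ 2 + x $ 3 = 1 \<and> (x $ 1)\<^sup>2 + (x $ 2)\<^sup>2 + (x $ 3)\<^sup>2 = 1}"

definition rational_points :: "(real ^ 'n) set" where
  "rational_points = {x. \<forall>i. x $ i \<in> \<rat>}"

definition primitive :: "int ^ 'n \<Rightarrow> bool" where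
  "primitive p \<longleftrightarrow> Gcd (range (\<lambda>i. p $ i)) = 1"

text \<open>
  A rational point need not be of the form \<open>p / q\<close> with \<open>p\<close> primitive, but every rational point
  of the three circles is, and \<open>q\<close> is then unique up to sign; see the lemmas
  \<open>circle_height_eq\<close> and \<open>circle_I_primitive\<close>, \<open>circle_II_primitive\<close>, \<open>circle_III_primitive\<close>.
\<close>

definition circle_height :: "real ^ 'n \<Rightarrow> real" where
  "circle_height x = (THE h. \<exists>(p :: int ^ 'n) (q :: int). q \<noteq> 0 \<and> primitive p \<and>
     x = (\<chi> i. of_int (p $ i) / of_int q) \<and> h = \<bar>of_int q\<bar>)"

definition rat_height :: "real \<Rightarrow> real" where
  "rat_height r = (THE h. \<exists>p q :: int. q \<noteq> 0 \<and> coprime p q \<and>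
     r = of_int p / of_int q \<and> h = (of_int q)\<^sup>2)"

definition sqrt2_rats :: "real set" where
  "sqrt2_rats = {sqrt 2 * t |t. t \<in> \<rat>}"

definition sqrt2_rat_height :: "real \<Rightarrow> real" where
  "sqrt2_rat_height r = (THE h. \<exists>p q :: int. q \<noteq> 0 \<and> coprime p q \<and>
     (odd q \<and> r = sqrt 2 * of_int p / of_int q \<and> h = (of_int q)\<^sup>2 \<or>
      odd p \<and> r = of_int p / (sqrt 2 * of_int q) \<and> h = 2 * (of_int q)\<^sup>2))"

lemma reduced_fraction_unique:
  fixes p q p' q' :: int
  assumes "q \<noteq> 0" "coprime p q" "q' \<noteq> 0" "coprime p' q'"
    and eq: "(of_int p :: real) / of_int q = of_int p' / of_int q'"
  shows "\<bar>q\<bar> = \<bar>q'\<bar>"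
proof -
  have "of_int p * of_int q' = (of_int p' * of_int q :: real)"
    using assms by (simp add: field_simps)
  then have e: "p * q' = p' * q"
    by (metis of_int_eq_iff of_int_mult)
  have "q dvd p * q'" "q' dvd p' * q"
    using e by (metis dvd_triv_right)+
  then have "q dvd q'" "q' dvd q"
    using assms by (simp_all add: coprime_dvd_mult_right_iff coprime_commute)
  then show ?thesis
    by (rule zdvd_antisym_abs)
qed

lemma rat_height_eq:
  assumes "q \<noteq> 0" "coprime p q"
  shows "rat_height (of_int p / of_int q) = (of_int q)\<^sup>2"
  unfolding rat_height_def
proof (rule the_equality)
  fix h :: real
  assume "\<exists>p' q' :: int. q' \<noteq> 0 \<and> coprime p' q' \<and>
    (of_int p :: real) / of_int q = of_int p' / of_int q' \<and> h = (of_int q')\<^sup>2"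
  then obtain p' q' :: int where q': "q' \<noteq> 0" "coprime p' q'"
    "(of_int p :: real) / of_int q = of_int p' / of_int q'" "h = (of_int q')\<^sup>2"
    by blast
  have "\<bar>q\<bar> = \<bar>q'\<bar>"
    by (rule reduced_fraction_unique[OF assms q'(1-3)])
  then have "(of_int q :: real)\<^sup>2 = (of_int q')\<^sup>2"
    by (metis of_int_abs power2_abs)
  then show "h = (of_int q)\<^sup>2"
    using q' by simp
qed (use assms in blast)

lemma sqrt2_fraction:
  "(of_int p :: real) / (sqrt 2 * of_int q) = sqrt 2 * (of_int p / of_int (2 * q))"
proof -
  have "sqrt 2 * sqrt 2 = (2 :: real)" by simp
  then show ?thesis
    by (cases "q = 0") (simp_all add: field_simps)
qed

text \<open>
  In terms of the reduced fraction \<open>t = p / q\<close>, the height of \<open>sqrt 2 * t\<close> is \<open>q\<^sup>2\<close> or \<open>q\<^sup>2 / 2\<close>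
  according to the parity of \<open>q\<close>.
\<close>

lemma sqrt2_rat_height_eq:
  assumes "q \<noteq> 0" "coprime p q"
  shows "sqrt2_rat_height (sqrt 2 * (of_int p / of_int q)) =
    (if odd q then (of_int q)\<^sup>2 else (of_int q)\<^sup>2 / 2)"
  unfolding sqrt2_rat_height_def
proof (rule the_equality)
  show "\<exists>p' q' :: int. q' \<noteq> 0 \<and> coprime p' q' \<and>
    (odd q' \<and> sqrt 2 * (of_int p / of_int q) = sqrt 2 * of_int p' / of_int q' \<and>
       (if odd q then (of_int q)\<^sup>2 else (of_int q)\<^sup>2 / 2 :: real) = (of_int q')\<^sup>2 \<or>
     odd p' \<and> sqrt 2 * (of_int p / of_int q) = of_int p' / (sqrt 2 * of_int q') \<and>
       (if odd q then (of_int q)\<^sup>2 else (of_int q)\<^sup>2 / 2 :: real) = 2 * (of_int q')\<^sup>2)"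
  proof (cases "odd q")
    case True
    then show ?thesis
      using assms by (intro exI[of _ p] exI[of _ q]) simp
  next
    case False
    then obtain k where k: "q = 2 * k" by blast
    have "odd p" "coprime p k" "k \<noteq> 0"
      using assms k by auto
    then show ?thesis
      using k by (intro exI[of _ p] exI[of _ k])
        (simp add: sqrt2_fraction power2_eq_square)
  qed
next
  fix h :: real
  assume "\<exists>p' q' :: int. q' \<noteq> 0 \<and> coprime p' q' \<and>
    (odd q' \<and> sqrt 2 * (of_int p / of_int q) = sqrt 2 * of_int p' / of_int q' \<and> h = (of_int q')\<^sup>2 \<or>
     odd p' \<and> sqrt 2 * (of_int p / of_int q) = of_int p' / (sqrt 2 * of_int q') \<and> h = 2 * (of_int q')\<^sup>2)"
  then obtain p' q' :: int where q': "q' \<noteq> 0" "coprime p' q'" and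
    c: "odd q' \<and> sqrt 2 * (of_int p / of_int q) = sqrt 2 * of_int p' / of_int q' \<and> h = (of_int q')\<^sup>2 \<or>
      odd p' \<and> sqrt 2 * (of_int p / of_int q) = of_int p' / (sqrt 2 * of_int q') \<and> h = 2 * (of_int q')\<^sup>2"
    by blast
  from c show "h = (if odd q then (of_int q)\<^sup>2 else (of_int q)\<^sup>2 / 2)"
  proof
    assume a: "odd q' \<and> sqrt 2 * (of_int p / of_int q) = sqrt 2 * of_int p' / of_int q' \<and> h = (of_int q')\<^sup>2"
    then have "sqrt 2 * (of_int p / of_int q) = sqrt 2 * (of_int p' / of_int q')"
      by (metis times_divide_eq_right)
    then have "(of_int p :: real) / of_int q = of_int p' / of_int q'"
      by (simp only: mult_cancel_left) simp
    from reduced_fraction_unique[OF assms q' this] have abs: "\<bar>q\<bar> = \<bar>q'\<bar>" .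
    then have "odd q" using a by (metis dvd_abs_iff)
    moreover have "(of_int q :: real)\<^sup>2 = (of_int q')\<^sup>2"
      using abs by (metis of_int_abs power2_abs)
    ultimately show ?thesis using a by simp
  next
    assume a: "odd p' \<and> sqrt 2 * (of_int p / of_int q) = of_int p' / (sqrt 2 * of_int q') \<and> h = 2 * (of_int q')\<^sup>2"
    then have "sqrt 2 * (of_int p / of_int q) = sqrt 2 * (of_int p' / of_int (2 * q'))"
      by (simp only: sqrt2_fraction)
    then have e: "(of_int p :: real) / of_int q = of_int p' / of_int (2 * q')"
      by (simp only: mult_cancel_left) simp
    have "2 * q' \<noteq> 0" "coprime p' (2 * q')" using q' a by auto
    from reduced_fraction_unique[OF assms this e] have abs: "\<bar>q\<bar> = \<bar>2 * q'\<bar>" .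
    then have "even q" by (metis dvd_abs_iff dvd_triv_left)
    moreover have "(of_int q :: real)\<^sup>2 = (of_int (2 * q'))\<^sup>2"
      using abs by (metis of_int_abs power2_abs)
    ultimately show ?thesis using a by (simp add: power2_eq_square)
  qed
qed

lemma primitive_dvd:
  assumes "primitive p" "\<And>i. a dvd b * p $ i"
  shows "a dvd b"
proof -
  have "a dvd Gcd ((*) b ` range (\<lambda>i. p $ i))"
    using assms(2) by (auto intro!: Gcd_greatest)
  then show ?thesis
    using assms(1) by (simp add: primitive_def Gcd_mult)
qed

lemma circle_height_eq:
  fixes p :: "int ^ 'n"
  assumes "q \<noteq> 0" "primitive p"
  shows "circle_height (\<chi> i. of_int (p $ i) / of_int q) = \<bar>of_int q\<bar>"
  unfolding circle_height_def
proof (rule the_equality)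
  fix h :: real
  assume "\<exists>(p' :: int ^ 'n) (q' :: int). q' \<noteq> 0 \<and> primitive p' \<and>
    (\<chi> i. (of_int (p $ i) :: real) / of_int q) = (\<chi> i. of_int (p' $ i) / of_int q') \<and> h = \<bar>of_int q'\<bar>"
  then obtain p' :: "int ^ 'n" and q' :: int where q': "q' \<noteq> 0" "primitive p'" "h = \<bar>of_int q'\<bar>"
    and eq: "\<And>i. (of_int (p $ i) :: real) / of_int q = of_int (p' $ i) / of_int q'"
    by (auto simp: vec_eq_iff)
  have e: "q' * p $ i = q * p' $ i" for i
  proof -
    have "of_int q' * of_int (p $ i) = (of_int q * of_int (p' $ i) :: real)"
      using eq[of i] assms q' by (simp add: field_simps)
    then show ?thesis by (metis of_int_eq_iff of_int_mult)
  qed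
  have "q dvd q'" by (rule primitive_dvd[OF assms(2)]) (simp add: e)
  moreover have "q' dvd q" by (rule primitive_dvd[OF q'(2)]) (simp flip: e)
  ultimately have "\<bar>q\<bar> = \<bar>q'\<bar>" by (rule zdvd_antisym_abs)
  then show "h = \<bar>of_int q\<bar>" using q' by (metis of_int_abs)
qed (intro exI conjI; use assms in simp)

lemma rational_points_fraction:
  fixes x :: "real ^ 'n"
  assumes "x \<in> rational_points" "x \<noteq> 0"
  obtains p :: "int ^ 'n" and a b :: int
  where "primitive p" "coprime a b" "a \<noteq> 0" "b \<noteq> 0" "\<And>i. of_int b * x $ i = of_int (a * p $ i)"
proof -
  have "\<forall>i. \<exists>m d :: int. d \<noteq> 0 \<and> x $ i = of_int m / of_int d"
  proof
    fix i
    have "x $ i \<in> \<rat>" using assms(1) by (simp add: rational_points_def)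
    then obtain m d :: int where "d > 0" "x $ i = of_int m / of_int d"
      by (rule Rats_cases')
    then show "\<exists>m d :: int. d \<noteq> 0 \<and> x $ i = of_int m / of_int d"
      by (metis less_irrefl)
  qed
  then obtain m d :: "'n \<Rightarrow> int" where d: "\<And>i. d i \<noteq> 0" "\<And>i. x $ i = of_int (m i) / of_int (d i)"
    by metis
  define D where "D = (\<Prod>i\<in>UNIV. d i)"
  define n where "n i = m i * (\<Prod>j\<in>UNIV - {i}. d j)" for i
  have D0: "D \<noteq> 0" using d by (simp add: D_def)
  have n: "of_int D * x $ i = of_int (n i)" for i
  proof -
    have "D = d i * (\<Prod>j\<in>UNIV - {i}. d j)"
      unfolding D_def by (rule prod.remove) auto
    then show ?thesis using d by (simp add: n_def)
  qed
  define g where "g = Gcd (range n)"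
  have "g \<noteq> 0"
  proof
    assume "g = 0"
    then have "\<forall>i. n i = 0" by (auto simp: g_def)
    then have "\<forall>i. x $ i = 0" using n D0 by (metis mult_eq_0_iff of_int_0 of_int_eq_0_iff)
    then show False using assms(2) by (simp add: vec_eq_iff)
  qed
  define p :: "int ^ 'n" where "p = (\<chi> i. n i div g)"
  have gp: "g * p $ i = n i" for i
    by (simp add: p_def g_def)
  have "(*) g ` range (\<lambda>i. p $ i) = range n"
    by (auto simp: image_image gp)
  then have "normalize (g * Gcd (range (\<lambda>i. p $ i))) = g"
    by (metis Gcd_mult g_def)
  then have "\<bar>g * Gcd (range (\<lambda>i. p $ i))\<bar> = \<bar>g\<bar>" by simp
  then have "\<bar>Gcd (range (\<lambda>i. p $ i))\<bar> = 1"
    using \<open>g \<noteq> 0\<close> by (simp add: abs_mult)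
  then have "primitive p" by (simp add: primitive_def)
  define e where "e = gcd g D"
  obtain a b where ab: "g = a * e" "D = b * e" "coprime a b"
    using gcd_coprime_exists[of g D] \<open>g \<noteq> 0\<close> unfolding e_def by (metis gcd_eq_0_iff)
  have nz: "a \<noteq> 0" "b \<noteq> 0" "e \<noteq> 0" using ab \<open>g \<noteq> 0\<close> D0 by auto
  have "of_int b * x $ i = of_int (a * p $ i)" for i
  proof -
    have "of_int e * (of_int b * x $ i) = of_int D * x $ i"
      unfolding ab(2) by simp
    also have "\<dots> = of_int (g * p $ i)"
      by (simp only: n gp)
    also have "\<dots> = of_int (a * e * p $ i)"
      by (simp only: ab(1)[symmetric])
    also have "\<dots> = of_int e * (of_int (a * p $ i) :: real)" by simp
    finally show ?thesis using nz(3) by simp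
  qed
  then show thesis
    using that \<open>primitive p\<close> ab(3) nz by blast
qed

lemma unit_fraction:
  fixes x :: "real ^ 'n" and p :: "int ^ 'n"
  assumes "primitive p" "\<bar>a\<bar> = 1" "b \<noteq> 0" "\<And>i. of_int b * x $ i = of_int (a * p $ i)"
  shows "\<exists>(p :: int ^ 'n) (q :: int). q \<noteq> 0 \<and> primitive p \<and> x = (\<chi> i. of_int (p $ i) / of_int q)"
proof (intro exI[of _ p] exI[of _ "a * b"] conjI)
  have "a * a = 1" using assms(2) by (metis abs_mult_self_eq mult.right_neutral)
  then have a: "of_int a * of_int a = (1 :: real)" by (metis of_int_1 of_int_mult)
  have "x $ i = of_int (p $ i) / of_int (a * b)" for i
  proof -
    have "of_int (a * b) * x $ i = of_int a * (of_int b * x $ i)" by simp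
    also have "\<dots> = (of_int a * of_int a) * of_int (p $ i)" by (simp add: assms(4))
    also have "\<dots> = of_int (p $ i)" by (simp add: a)
    finally show ?thesis using assms(2,3) by (auto simp: field_simps)
  qed
  then show "x = (\<chi> i. of_int (p $ i) / of_int (a * b))" by (simp add: vec_eq_iff)
qed (use assms in auto)

lemma circle_norm_unit:
  fixes x :: "real ^ 2" and p :: "int ^ 2" and k :: int
  assumes "a \<noteq> 0" "coprime a b" "\<And>i. of_int b * x $ i = of_int (a * p $ i)"
    and "(x $ 1)\<^sup>2 + (x $ 2)\<^sup>2 = of_int k" "k = 1 \<or> k = 2"
  shows "\<bar>a\<bar> = 1"
proof -
  have "of_int (b\<^sup>2 * k) = (of_int b * x $ 1)\<^sup>2 + (of_int b * x $ 2)\<^sup>2"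
    using assms(4) by (simp add: power_mult_distrib flip: distrib_left)
  also have "\<dots> = of_int ((a * p $ 1)\<^sup>2 + (a * p $ 2)\<^sup>2)"
    unfolding assms(3) by simp
  finally have "b\<^sup>2 * k = (a * p $ 1)\<^sup>2 + (a * p $ 2)\<^sup>2"
    by (simp only: of_int_eq_iff)
  also have "\<dots> = a\<^sup>2 * ((p $ 1)\<^sup>2 + (p $ 2)\<^sup>2)"
    by (simp add: power_mult_distrib distrib_left)
  finally have "a\<^sup>2 dvd b\<^sup>2 * k"
    by (metis dvd_triv_left)
  moreover have "coprime (a\<^sup>2) (b\<^sup>2)" using assms(2) by simp
  ultimately have "a\<^sup>2 dvd k" using coprime_dvd_mult_right_iff by blast
  moreover have "k > 0" using assms(5) by auto
  ultimately have "a\<^sup>2 \<le> k" by (rule zdvd_imp_le)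
  then have "\<bar>a\<bar>\<^sup>2 < 2\<^sup>2" using assms(5) by auto
  then have "\<bar>a\<bar> < 2" by (rule power2_less_imp_less) simp
  then show ?thesis using assms(1) by linarith
qed

lemma circle_I_primitive:
  assumes "x \<in> circle_I \<inter> rational_points"
  shows "\<exists>(p :: int ^ 2) (q :: int). q \<noteq> 0 \<and> primitive p \<and> x = (\<chi> i. of_int (p $ i) / of_int q)"
proof -
  have x: "x \<in> rational_points" "x \<noteq> 0" "(x $ 1)\<^sup>2 + (x $ 2)\<^sup>2 = of_int 1"
    using assms by (auto simp: circle_I_def)
  from x(1,2) obtain p :: "int ^ 2" and a b where p: "primitive p" "coprime a b" "a \<noteq> 0" "b \<noteq> 0"
    "\<And>i. of_int b * x $ i = of_int (a * p $ i)"
    by (rule rational_points_fraction) blast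
  have "\<bar>a\<bar> = 1"
    by (rule circle_norm_unit[OF p(3,2,5) x(3)]) simp
  then show ?thesis by (rule unit_fraction[OF p(1) _ p(4,5)])
qed

lemma circle_II_primitive:
  assumes "x \<in> circle_II \<inter> rational_points"
  shows "\<exists>(p :: int ^ 2) (q :: int). q \<noteq> 0 \<and> primitive p \<and> x = (\<chi> i. of_int (p $ i) / of_int q)"
proof -
  have x: "x \<in> rational_points" "x \<noteq> 0" "(x $ 1)\<^sup>2 + (x $ 2)\<^sup>2 = of_int 2"
    using assms by (auto simp: circle_II_def)
  from x(1,2) obtain p :: "int ^ 2" and a b where p: "primitive p" "coprime a b" "a \<noteq> 0" "b \<noteq> 0"
    "\<And>i. of_int b * x $ i = of_int (a * p $ i)"
    by (rule rational_points_fraction) blast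
  have "\<bar>a\<bar> = 1"
    by (rule circle_norm_unit[OF p(3,2,5) x(3)]) simp
  then show ?thesis by (rule unit_fraction[OF p(1) _ p(4,5)])
qed

lemma circle_III_primitive:
  assumes "x \<in> circle_III \<inter> rational_points"
  shows "\<exists>(p :: int ^ 3) (q :: int). q \<noteq> 0 \<and> primitive p \<and> x = (\<chi> i. of_int (p $ i) / of_int q)"
proof -
  have x: "x \<in> rational_points" "x \<noteq> 0" "x $ 1 + x $ 2 + x $ 3 = 1"
    using assms by (auto simp: circle_III_def)
  from x(1,2) obtain p :: "int ^ 3" and a b where p: "primitive p" "coprime a b" "a \<noteq> 0" "b \<noteq> 0"
    "\<And>i. of_int b * x $ i = of_int (a * p $ i)"
    by (rule rational_points_fraction) blast
  have "of_int b = of_int b * (x $ 1 + x $ 2 + x $ 3)" using x by simp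
  also have "\<dots> = of_int b * x $ 1 + of_int b * x $ 2 + of_int b * x $ 3" by (simp add: algebra_simps)
  also have "\<dots> = of_int (a * (p $ 1 + p $ 2 + p $ 3))"
    unfolding p(5) by (simp add: algebra_simps)
  finally have "b = a * (p $ 1 + p $ 2 + p $ 3)" by (simp only: of_int_eq_iff)
  then have "a dvd b" by simp
  then have "\<bar>a\<bar> = 1" using p(2) by (simp add: coprime_absorb_left)
  then show ?thesis by (rule unit_fraction[OF p(1) _ p(4,5)])
qed

end

theory Submission
  imports Defs
begin

text \<open>
  Stereographic projection from a rational point parametrizes each circle, minus that point, by the
  real line: \<open>dist (f s) (f u) = c * \<bar>s - u\<bar> / (w s * w u)\<close> with \<open>w\<^sup>2\<close> a positive quadratic
  polynomial.  For a suitable choice of the coordinate, \<open>f\<close> matches the two sets of rational points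
  and multiplies the height of \<open>z\<close> by exactly \<open>(w z)\<^sup>2\<close>.  So height times distance gets multiplied
  by \<open>c * w z / w s\<close>, which tends to \<open>c\<close> as \<open>z\<close> approaches \<open>s\<close>; points far from \<open>s\<close> do not
  contribute to the limit superior, since \<open>w\<close> is bounded below and only finitely many points of
  bounded height lie in a bounded set.
\<close>

section \<open>Limits superior along complements of finite sets\<close>

lemma eventually_cofinite_principal:
  "eventually P (inf cofinite (principal Z)) \<longleftrightarrow> finite {z \<in> Z. \<not> P z}"
  by (simp add: eventually_inf_principal eventually_cofinite)

text \<open>The complements of finite subsets of \<open>Z\<close> form a base of
  \<open>inf cofinite (principal Z)\<close>: for an eventual property \<open>Q\<close>, the finite
  set to remove consists of the exceptions to \<open>Q\<close> in \<open>Z\<close>. This opens the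
  way to filter arguments.\<close>

lemma lagrange_number_Limsup:
  "lagrange_number Z ht P =
     Limsup (inf cofinite (principal Z)) (\<lambda>z. 1 / ennreal (ht z * dist P z))"
proof (rule antisym)
  let ?f = "\<lambda>z. 1 / ennreal (ht z * dist P z)"
  show "lagrange_number Z ht P \<le> Limsup (inf cofinite (principal Z)) ?f"
    unfolding lagrange_number_def Limsup_def
  proof (rule INF_mono)
    fix Q assume "Q \<in> {Q. eventually Q (inf cofinite (principal Z))}"
    then show "\<exists>F\<in>{F. F \<subseteq> Z \<and> finite F}. (SUP z\<in>Z - F. ?f z) \<le> (SUP z\<in>Collect Q. ?f z)"
      by (intro bexI[of _ "{z \<in> Z. \<not> Q z}"] SUP_subset_mono)
        (auto simp: eventually_cofinite_principal)
  qed
  show "Limsup (inf cofinite (principal Z)) ?f \<le> lagrange_number Z ht P"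
    unfolding lagrange_number_def Limsup_def
  proof (rule INF_mono)
    fix F assume F: "F \<in> {F. F \<subseteq> Z \<and> finite F}"
    have "{z \<in> Z. z \<notin> Z - F} = F" using F by auto
    then have "eventually (\<lambda>z. z \<in> Z - F) (inf cofinite (principal Z))"
      using F unfolding eventually_cofinite_principal by simp
    then show "\<exists>Q\<in>{Q. eventually Q (inf cofinite (principal Z))}.
        (SUP z\<in>Collect Q. ?f z) \<le> (SUP z\<in>Z - F. ?f z)"
      by (intro bexI[of _ "\<lambda>z. z \<in> Z - F"]) (simp_all only: Collect_mem_eq mem_Collect_eq order_refl)
  qed
qed

text \<open>One more point does not affect finiteness. This absorbs the centre of projection, the
  one rational point that the parametrization misses.\<close>

lemma cofinite_principal_insert:
  "inf cofinite (principal (insert p Z)) = inf cofinite (principal Z)"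
  unfolding filter_eq_iff eventually_cofinite_principal
proof
  fix Q
  have "{z \<in> Z. \<not> Q z} \<subseteq> {z \<in> insert p Z. \<not> Q z}"
    "{z \<in> insert p Z. \<not> Q z} \<subseteq> insert p {z \<in> Z. \<not> Q z}"
    by auto
  then show "finite {z \<in> insert p Z. \<not> Q z} \<longleftrightarrow> finite {z \<in> Z. \<not> Q z}"
    by (meson finite_insert finite_subset)
qed

lemma cofinite_principal_image:
  assumes "inj f"
  shows "inf cofinite (principal (f ` Z)) = filtermap f (inf cofinite (principal Z))"
  unfolding filter_eq_iff eventually_filtermap eventually_cofinite_principal
proof
  fix Q
  have "{z \<in> f ` Z. \<not> Q z} = f ` {z \<in> Z. \<not> Q (f z)}" by auto
  then show "finite {z \<in> f ` Z. \<not> Q z} \<longleftrightarrow> finite {z \<in> Z. \<not> Q (f z)}"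
    by (simp add: finite_image_iff inj_on_subset[OF assms])
qed

text \<open>Multiplication by a finite constant is monotone and continuous on
  \<open>ennreal\<close>; along the trivial filter both sides are 0.\<close>

lemma Limsup_cmult_ennreal:
  fixes c :: ennreal
  assumes "c < top"
  shows "Limsup F (\<lambda>x. c * f x) = c * Limsup F f"
proof (cases "F = bot")
  case False
  have "mono ((*) c)" by (intro monoI mult_left_mono) auto
  moreover have "continuous_on UNIV ((*) c)"
    using assms by (intro ennreal_continuous_on_cmult continuous_on_id)
  ultimately show ?thesis
    using False Limsup_compose_continuous_mono[of "(*) c" F f] by blast
qed (simp add: bot_ennreal)

text \<open>For \<open>a\<close> at most 0, \<open>ennreal a\<close> is 0 and its reciprocal is
  infinite, while \<open>1 / r\<close> is positive, so both sides fail together.\<close>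

lemma inverse_ennreal_le_iff:
  assumes "0 < r"
  shows "1 / ennreal a \<le> ennreal r \<longleftrightarrow> 1 / r \<le> a"
proof (cases "0 < a")
  case True
  then have "1 / ennreal a = ennreal (1 / a)"
    using divide_ennreal[of 1 a] by simp
  then show ?thesis using True assms by (simp add: field_simps)
next
  case False
  then have "1 / ennreal a = top"
    by (simp add: ennreal_neg)
  then show ?thesis using False assms
    by (simp add: top_unique) (smt (verit) divide_pos_pos)
qed

text \<open>
  Asymptotic comparison is only required where \<open>a\<close> stays bounded: where it tends to infinity
  the terms do not contribute to the limit superior.
\<close>

lemma Limsup_inverse_le:
  fixes a b :: "'a \<Rightarrow> real"
  assumes "\<And>l K. 1 < l \<Longrightarrow> eventually (\<lambda>z. b z \<le> l * a z \<or> K \<le> a z) F"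
  shows "Limsup F (\<lambda>z. 1 / ennreal (a z)) \<le> Limsup F (\<lambda>z. 1 / ennreal (b z))"
    (is "?A \<le> ?B")
proof (rule dense_ge)
  fix y assume "?B < y"
  \<comment> \<open>The gap between \<open>y'\<close> and \<open>y\<close> leaves room for a
    comparison factor \<open>r / r'\<close> above 1.\<close>
  then obtain y' where y': "?B < y'" "y' < y" using dense by blast
  show "?A \<le> y"
  proof (cases "y = top")
    case False
    then obtain r where r: "y = ennreal r" "r \<ge> 0" by (cases y) auto
    obtain r' where r': "y' = ennreal r'" "r' \<ge> 0" using y' by (cases y') auto
    have "r' < r" using y'(2) r r' by (simp add: ennreal_less_iff)
    have "y' \<noteq> 0" using y'(1) by auto
    then have "0 < r'" using r' by (cases "r' = 0") auto
    \<comment> \<open>With \<open>K = 1 / r\<close> the second alternative is already the desired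
      bound; in the first, \<open>b z\<close> is at least \<open>1 / r'\<close>, and dividing by
      \<open>l = r / r'\<close> gives the same bound on \<open>a z\<close>.\<close>
    have "eventually (\<lambda>z. b z \<le> r / r' * a z \<or> 1 / r \<le> a z) F"
      using \<open>r' < r\<close> \<open>0 < r'\<close> by (intro assms) simp
    moreover have "eventually (\<lambda>z. 1 / ennreal (b z) < ennreal r') F"
      using Limsup_lessD[OF y'(1)] r' by simp
    ultimately have "eventually (\<lambda>z. 1 / ennreal (a z) \<le> y) F"
    proof eventually_elim
      case (elim z)
      have "1 / r' \<le> b z"
        using elim(2) \<open>0 < r'\<close> by (simp add: less_imp_le flip: inverse_ennreal_le_iff)
      then have "1 / r \<le> a z"
        using elim(1) \<open>0 < r'\<close> \<open>r' < r\<close> by (auto simp: field_simps)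
      then show ?case
        using \<open>0 < r'\<close> \<open>r' < r\<close> by (simp add: r(1) inverse_ennreal_le_iff)
    qed
    then show ?thesis by (rule Limsup_bounded)
  qed simp
qed

section \<open>Transfer of Lagrange numbers and spectra through a parametrization\<close>

lemma finite_height_dist:
  fixes h :: "real \<Rightarrow> real"
  assumes fin: "\<And>H B. finite {z \<in> Z. h z \<le> H \<and> \<bar>z\<bar> \<le> B}"
    and h: "\<And>z. z \<in> Z \<Longrightarrow> 1 \<le> h z" and "0 < d"
  shows "finite {z \<in> Z. d \<le> \<bar>s - z\<bar> \<and> h z * \<bar>s - z\<bar> \<le> C}"
proof (rule finite_subset[OF _ fin])
  show "{z \<in> Z. d \<le> \<bar>s - z\<bar> \<and> h z * \<bar>s - z\<bar> \<le> C} \<subseteq> {z \<in> Z. h z \<le> C / d \<and> \<bar>z\<bar> \<le> C + \<bar>s\<bar>}"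
  proof clarify
    fix z assume z: "z \<in> Z" "d \<le> \<bar>s - z\<bar>" "h z * \<bar>s - z\<bar> \<le> C"
    \<comment> \<open>Distance at least \<open>d\<close> bounds the height by \<open>C / d\<close>;
      height at least 1 bounds the distance by \<open>C\<close>, so \<open>z\<close> stays in a
      bounded interval.\<close>
    have "h z * d \<le> h z * \<bar>s - z\<bar>" "1 * \<bar>s - z\<bar> \<le> h z * \<bar>s - z\<bar>"
      using z h[of z] by (intro mult_left_mono mult_right_mono; simp)+
    then have "h z * d \<le> C" "1 * \<bar>s - z\<bar> \<le> C" using z(3) by (blast intro: order_trans)+
    then show "h z \<le> C / d \<and> \<bar>z\<bar> \<le> C + \<bar>s\<bar>"
      using \<open>0 < d\<close> by (auto simp: field_simps)
  qed
qed

text \<open>\<open>p\<close> stands for the centre of projection. In the proof, \<open>a\<close> is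
  height times distance on the curve and \<open>b\<close> is \<open>c\<close> times that product on
  the line; their reciprocals are shown to have the same limit superior.\<close>

lemma lagrange_number_param:
  fixes f :: "real \<Rightarrow> 'a::metric_space" and h w :: "real \<Rightarrow> real"
  assumes fin: "\<And>H B. finite {z \<in> Z. h z \<le> H \<and> \<bar>z\<bar> \<le> B}"
    and h: "\<And>z. z \<in> Z \<Longrightarrow> 1 \<le> h z"
    and inj: "inj f" and Y: "Y = insert p (f ` Z)"
    and "0 < c" "0 < m" and m: "\<And>u. m \<le> w u" and cont: "continuous_on UNIV w"
    and dist: "\<And>s u. dist (f s) (f u) = c * \<bar>s - u\<bar> / (w s * w u)"
    and ht: "\<And>z. z \<in> Z \<Longrightarrow> g (f z) = h z * (w z)\<^sup>2"
  shows "lagrange_number Y g (f s) = ennreal (1 / c) * lagrange_number Z h s"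
proof -
  let ?F = "inf cofinite (principal Z)"
  define a where "a z = g (f z) * dist (f s) (f z)" for z
  define b where "b z = c * (h z * \<bar>s - z\<bar>)" for z
  have wpos: "0 < w u" for u using m[of u] \<open>0 < m\<close> by linarith
  have ab: "a z = b z * (w z / w s)" if "z \<in> Z" for z
    using wpos[of z] wpos[of s] by (simp add: a_def b_def dist ht[OF that] power2_eq_square)
  have b0: "0 \<le> b z" if "z \<in> Z" for z
    using h[OF that] \<open>0 < c\<close> by (simp add: b_def)
  \<comment> \<open>All but finitely many points of \<open>Z\<close> are either so close to
    \<open>s\<close> that \<open>w\<close> changes by a factor below \<open>l\<close> in both
    directions, or have \<open>b z\<close> large.\<close>
  have near: "eventually (\<lambda>z. z \<in> Z \<and> (w z / w s < l \<and> w s / w z < l \<or> K < b z)) ?F"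
    if "1 < l" for l K
  proof -
    have "(w \<longlongrightarrow> w s) (at s)"
      using cont by (simp add: continuous_on_def)
    then have "((\<lambda>z. w z / w s) \<longlongrightarrow> w s / w s) (at s)" "((\<lambda>z. w s / w z) \<longlongrightarrow> w s / w s) (at s)"
      using wpos[of s] by (intro tendsto_divide tendsto_const; simp)+
    then have "eventually (\<lambda>z. w z / w s < l) (at s)" "eventually (\<lambda>z. w s / w z < l) (at s)"
      using that wpos[of s] by (auto elim!: order_tendstoD(2))
    then have "eventually (\<lambda>z. w z / w s < l \<and> w s / w z < l) (at s)"
      by (rule eventually_conj)
    then obtain d where d: "0 < d" "\<And>z. z \<noteq> s \<Longrightarrow> dist z s < d \<Longrightarrow> w z / w s < l \<and> w s / w z < l"
      unfolding eventually_at by blast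
    \<comment> \<open>The punctured neighbourhood leaves out \<open>z = s\<close>, where both ratios
      are 1.\<close>
    have d': "w z / w s < l \<and> w s / w z < l" if "\<bar>s - z\<bar> < d" for z
      using d(2)[of z] that \<open>1 < l\<close> wpos[of s]
      by (cases "z = s") (simp_all add: dist_real_def abs_minus_commute)
    have "{z \<in> Z. \<not> (z \<in> Z \<and> (w z / w s < l \<and> w s / w z < l \<or> K < b z))}
       \<subseteq> {z \<in> Z. d \<le> \<bar>s - z\<bar> \<and> h z * \<bar>s - z\<bar> \<le> K / c}"
    proof
      fix z assume z: "z \<in> {z \<in> Z. \<not> (z \<in> Z \<and> (w z / w s < l \<and> w s / w z < l \<or> K < b z))}"
      then have "d \<le> \<bar>s - z\<bar>" "b z \<le> K" using d'[of z] by (simp_all add: not_less) argo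
      then show "z \<in> {z \<in> Z. d \<le> \<bar>s - z\<bar> \<and> h z * \<bar>s - z\<bar> \<le> K / c}"
        using z \<open>0 < c\<close> by (simp add: b_def pos_le_divide_eq mult.commute)
    qed
    then show ?thesis
      unfolding eventually_cofinite_principal
      by (rule finite_subset) (rule finite_height_dist[OF fin h d(1)])
  qed
  have "lagrange_number Y g (f s) = Limsup (filtermap f ?F) (\<lambda>z. 1 / ennreal (g z * dist (f s) z))"
    unfolding lagrange_number_Limsup Y cofinite_principal_insert cofinite_principal_image[OF inj] ..
  also have "\<dots> = Limsup ?F (\<lambda>z. 1 / ennreal (a z))"
    unfolding a_def by (rule Limsup_filtermap_eq[OF inj])
  also have "\<dots> = Limsup ?F (\<lambda>z. 1 / ennreal (b z))"
  proof (rule antisym; rule Limsup_inverse_le)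
    fix l K :: real assume "1 < l"
    \<comment> \<open>Largeness is known for \<open>b\<close> but wanted for \<open>a\<close>. Since
      \<open>w z / w s\<close> is at least \<open>m / w s\<close>, this inflated threshold for
      \<open>b\<close> suffices.\<close>
    let ?K = "\<bar>K\<bar> * w s / m"
    show "eventually (\<lambda>z. b z \<le> l * a z \<or> K \<le> a z) ?F"
      using near[OF \<open>1 < l\<close>, of ?K]
    proof eventually_elim
      case (elim z)
      then have z: "z \<in> Z" by simp
      from elim consider "w s / w z < l" | "?K < b z" by blast
      then show ?case
      proof cases
        case 1
        then have "1 \<le> l * (w z / w s)"
          using wpos[of z] wpos[of s] by (simp add: field_simps)
        then have "b z * 1 \<le> b z * (l * (w z / w s))"
          using b0[OF z] by (rule mult_left_mono)
        then show ?thesis by (simp add: ab[OF z] mult.left_commute)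
      next
        case 2
        have "\<bar>K\<bar> = ?K * (m / w s)"
          using \<open>0 < m\<close> wpos[of s] by simp
        also have "\<dots> \<le> b z * (w z / w s)"
          using 2 m[of z] wpos[of s] b0[OF z] \<open>0 < m\<close>
          by (intro mult_mono divide_right_mono) auto
        finally have "\<bar>K\<bar> \<le> a z" by (simp only: ab[OF z])
        then show ?thesis by linarith
      qed
    qed
    show "eventually (\<lambda>z. a z \<le> l * b z \<or> K \<le> b z) ?F"
      using near[OF \<open>1 < l\<close>, of K]
    proof eventually_elim
      case (elim z)
      then have z: "z \<in> Z" by simp
      have "b z * (w z / w s) \<le> b z * l" if "w z / w s < l"
        using that b0[OF z] by (intro mult_left_mono) auto
      then show ?case using elim less_imp_le unfolding ab[OF z] mult.commute[of l] by blast
    qed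
  qed
  also have "\<dots> = Limsup ?F (\<lambda>z. ennreal (1 / c) * (1 / ennreal (h z * \<bar>s - z\<bar>)))"
  proof (intro Limsup_eq always_eventually allI)
    fix z
    \<comment> \<open>Where the product is not positive both sides are infinite, as
      \<open>1 / c\<close> is positive.\<close>
    show "1 / ennreal (b z) = ennreal (1 / c) * (1 / ennreal (h z * \<bar>s - z\<bar>))"
    proof (cases "0 < h z * \<bar>s - z\<bar>")
      case True
      then show ?thesis
        using divide_ennreal[of 1 "b z"] divide_ennreal[of 1 "h z * \<bar>s - z\<bar>"] \<open>0 < c\<close>
          ennreal_mult[of "1 / c" "1 / (h z * \<bar>s - z\<bar>)"]
        by (simp add: b_def)
    next
      case False
      then have "b z \<le> 0" using \<open>0 < c\<close> by (simp add: b_def mult_le_0_iff not_less)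
      then show ?thesis using False \<open>0 < c\<close>
        by (simp add: ennreal_neg ennreal_mult_top)
    qed
  qed
  also have "\<dots> = ennreal (1 / c) * lagrange_number Z h s"
    unfolding lagrange_number_Limsup dist_real_def by (rule Limsup_cmult_ennreal) simp
  finally show ?thesis .
qed

text \<open>As \<open>p\<close> lies in \<open>R\<close>, the points of \<open>X\<close> outside
  \<open>R\<close> are exactly the images of parameters outside \<open>Z\<close>; the positive
  factor \<open>1 / c\<close> preserves the positivity condition of the spectrum.\<close>

lemma lagrange_spectrum_param:
  fixes f :: "real \<Rightarrow> 'a::metric_space" and h w :: "real \<Rightarrow> real"
  assumes fin: "\<And>H B. finite {z \<in> Z. h z \<le> H \<and> \<bar>z\<bar> \<le> B}"
    and h: "\<And>z. z \<in> Z \<Longrightarrow> 1 \<le> h z"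
    and inj: "inj f" and X: "X = insert p (range f)"
    and p: "p \<in> R" and R: "\<And>u. f u \<in> R \<longleftrightarrow> u \<in> Z"
    and "0 < c" "0 < m" and m: "\<And>u. m \<le> w u" and cont: "continuous_on UNIV w"
    and dist: "\<And>s u. dist (f s) (f u) = c * \<bar>s - u\<bar> / (w s * w u)"
    and ht: "\<And>z. z \<in> Z \<Longrightarrow> g (f z) = h z * (w z)\<^sup>2"
  shows "lagrange_spectrum X (X \<inter> R) g =
    (\<lambda>L. ennreal (1 / c) * L) ` lagrange_spectrum UNIV Z h"
proof -
  have Y: "X \<inter> R = insert p (f ` Z)" using X p R by auto
  have L: "lagrange_number (X \<inter> R) g (f s) = ennreal (1 / c) * lagrange_number Z h s" for s
    by (rule lagrange_number_param[OF fin h inj Y \<open>0 < c\<close> \<open>0 < m\<close> m cont dist ht])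
  have "X - X \<inter> R = f ` (UNIV - Z)" using X p R by auto
  then have "lagrange_spectrum X (X \<inter> R) g =
      {lagrange_number (X \<inter> R) g (f s) |s. s \<in> UNIV - Z \<and> 0 < lagrange_number (X \<inter> R) g (f s)}"
    unfolding lagrange_spectrum_def by auto
  also have "\<dots> = {ennreal (1 / c) * lagrange_number Z h s |s. s \<in> UNIV - Z \<and> 0 < lagrange_number Z h s}"
    using \<open>0 < c\<close> by (simp add: L ennreal_zero_less_mult_iff)
  also have "\<dots> = (\<lambda>L. ennreal (1 / c) * L) ` lagrange_spectrum UNIV Z h"
    unfolding lagrange_spectrum_def by blast
  finally show ?thesis .
qed

section \<open>Finiteness and lower bounds for the heights on the line\<close>

lemma finite_bounded_fractions:
  fixes H B :: real
  shows "finite {t :: real. \<exists>p q :: int. t = of_int p / of_int q \<and> (of_int q)\<^sup>2 \<le> H \<and> \<bar>t\<bar> \<le> B}"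
proof (rule finite_subset)
  \<comment> \<open>An integer is at most its square in absolute value, so \<open>H\<close> bounds
    the denominator, and then \<open>B\<close> bounds the numerator.\<close>
  define K where "K = \<lceil>H\<rceil>"
  define M where "M = \<lceil>B\<rceil> * K"
  show "finite ((\<lambda>(p, q). of_int p / of_int q :: real) ` ({-M..M} \<times> {-K..K}))" by simp
  show "{t :: real. \<exists>p q :: int. t = of_int p / of_int q \<and> (of_int q)\<^sup>2 \<le> H \<and> \<bar>t\<bar> \<le> B}
      \<subseteq> (\<lambda>(p, q). of_int p / of_int q) ` ({-M..M} \<times> {-K..K})"
  proof clarify
    fix p q :: int
    assume q: "(of_int q :: real)\<^sup>2 \<le> H" and p: "\<bar>of_int p / of_int q :: real\<bar> \<le> B"
    have "0 \<le> B" using p by linarith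
    have "\<bar>q\<bar> \<le> q\<^sup>2"
      using self_le_power[of "\<bar>q\<bar>" 2] by (cases "q = 0") auto
    then have "\<bar>of_int q :: real\<bar> \<le> (of_int q)\<^sup>2"
      by (metis of_int_abs of_int_le_iff of_int_power)
    then have "of_int \<bar>q\<bar> \<le> (of_int K :: real)"
      using q le_of_int_ceiling[of H] unfolding K_def of_int_abs by linarith
    then have qK: "\<bar>q\<bar> \<le> K" by (simp only: of_int_le_iff)
    show "of_int p / of_int q \<in> (\<lambda>(p, q). of_int p / of_int q :: real) ` ({-M..M} \<times> {-K..K})"
    proof (cases "q = 0")
      \<comment> \<open>Division by zero gives 0, and the pair \<open>(0, 0)\<close> lies in the
        box.\<close>
      case True
      then show ?thesis
        using qK \<open>0 \<le> B\<close> by (intro image_eqI[of _ _ "(0, 0)"]) (auto simp: M_def)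
    next
      case False
      then have "\<bar>of_int p :: real\<bar> \<le> B * \<bar>of_int q\<bar>"
        using p by (simp add: abs_divide field_simps)
      also have "\<dots> \<le> of_int \<lceil>B\<rceil> * of_int K"
        using \<open>0 \<le> B\<close> qK by (intro mult_mono) (auto simp flip: of_int_abs)
      finally have "of_int \<bar>p\<bar> \<le> (of_int M :: real)" by (simp add: M_def)
      then have "\<bar>p\<bar> \<le> M" by (simp only: of_int_le_iff)
      then show ?thesis
        using qK by (intro image_eqI[of _ _ "(p, q)"]) auto
    qed
  qed
qed

lemma one_le_of_int_square: "q \<noteq> 0 \<Longrightarrow> 1 \<le> (of_int q :: real)\<^sup>2"
  by (metis linorder_not_le of_int_1_le_iff of_int_power zero_less_power2 zless_imp_add1_zle add_0)

lemma rat_height_ge_1: "z \<in> \<rat> \<Longrightarrow> 1 \<le> rat_height z"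
  by (erule Rats_cases') (simp add: rat_height_eq one_le_of_int_square)

lemma finite_rat_height: "finite {z \<in> \<rat>. rat_height z \<le> H \<and> \<bar>z\<bar> \<le> B}"
proof (rule finite_subset[OF _ finite_bounded_fractions])
  show "{z \<in> \<rat>. rat_height z \<le> H \<and> \<bar>z\<bar> \<le> B}
    \<subseteq> {t. \<exists>p q :: int. t = of_int p / of_int q \<and> (of_int q)\<^sup>2 \<le> H \<and> \<bar>t\<bar> \<le> B}"
  proof clarify
    fix z :: real assume z: "z \<in> \<rat>" "rat_height z \<le> H" "\<bar>z\<bar> \<le> B"
    from z(1) obtain p q :: int where "q > 0" "coprime p q" "z = of_int p / of_int q"
      by (rule Rats_cases')
    then show "\<exists>p q :: int. z = of_int p / of_int q \<and> (of_int q)\<^sup>2 \<le> H \<and> \<bar>z\<bar> \<le> B"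
      using z rat_height_eq[of q p] by auto
  qed
qed

lemma sqrt2_ratsE:
  assumes "z \<in> sqrt2_rats"
  obtains p q :: int where "q > 0" "coprime p q" "z = sqrt 2 * (of_int p / of_int q)"
    "sqrt2_rat_height z = (if odd q then (of_int q)\<^sup>2 else (of_int q)\<^sup>2 / 2)"
proof -
  obtain p q :: int where q: "q > 0" "coprime p q" "z = sqrt 2 * (of_int p / of_int q)"
    using assms by (auto simp: sqrt2_rats_def elim!: Rats_cases')
  moreover have "sqrt2_rat_height z = (if odd q then (of_int q)\<^sup>2 else (of_int q)\<^sup>2 / 2)"
    unfolding q(3) by (rule sqrt2_rat_height_eq) (use q in auto)
  ultimately show ?thesis by (rule that)
qed

lemma sqrt2_rat_height_ge_1:
  assumes "z \<in> sqrt2_rats"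
  shows "1 \<le> sqrt2_rat_height z"
proof -
  obtain q :: int where q: "q > 0"
    "sqrt2_rat_height z = (if odd q then (of_int q)\<^sup>2 else (of_int q)\<^sup>2 / 2)"
    using assms by (rule sqrt2_ratsE)
  \<comment> \<open>An even positive denominator is at least 2, which makes up for the halved
    height.\<close>
  have "2 \<le> (of_int q :: real)\<^sup>2" if even: "even q"
  proof -
    have "2 \<le> q" using q(1) even by (auto elim!: evenE)
    then have "2\<^sup>2 \<le> (of_int q :: real)\<^sup>2" by (intro power_mono) auto
    then show ?thesis by simp
  qed
  then show ?thesis
    using q one_le_of_int_square[of q] by simp
qed

lemma finite_sqrt2_rat_height: "finite {z \<in> sqrt2_rats. sqrt2_rat_height z \<le> H \<and> \<bar>z\<bar> \<le> B}"
proof (rule finite_subset)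
  \<comment> \<open>The bound \<open>2 * H\<close> allows for even denominators, whose squares are
    twice the height; \<open>B\<close> carries over because \<open>sqrt 2\<close> is at least
    1.\<close>
  let ?A = "{t :: real. \<exists>p q :: int. t = of_int p / of_int q \<and> (of_int q)\<^sup>2 \<le> 2 * H \<and> \<bar>t\<bar> \<le> B}"
  show "finite ((*) (sqrt 2) ` ?A)"
    by (intro finite_imageI finite_bounded_fractions)
  show "{z \<in> sqrt2_rats. sqrt2_rat_height z \<le> H \<and> \<bar>z\<bar> \<le> B} \<subseteq> (*) (sqrt 2) ` ?A"
  proof clarify
    fix z assume z: "z \<in> sqrt2_rats" "sqrt2_rat_height z \<le> H" "\<bar>z\<bar> \<le> B"
    from z(1) obtain p q :: int where q: "q > 0" "coprime p q" "z = sqrt 2 * (of_int p / of_int q)"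
      "sqrt2_rat_height z = (if odd q then (of_int q)\<^sup>2 else (of_int q)\<^sup>2 / 2)"
      by (rule sqrt2_ratsE)
    define t :: real where "t = of_int p / of_int q"
    have "1 * \<bar>t\<bar> \<le> sqrt 2 * \<bar>t\<bar>" by (intro mult_right_mono) auto
    then have "\<bar>t\<bar> \<le> B" using z(3) q(3) by (simp add: t_def abs_mult)
    moreover have "(of_int q)\<^sup>2 \<le> 2 * H"
    proof (cases "odd q")
      case True
      then have "(of_int q)\<^sup>2 \<le> H" using z(2) q(4) by simp
      moreover have "0 \<le> (of_int q :: real)\<^sup>2" by simp
      ultimately show ?thesis by linarith
    next
      case False
      then show ?thesis using z(2) q(4) by simp
    qed
    ultimately have "t \<in> ?A" unfolding t_def by blast
    then show "z \<in> (*) (sqrt 2) ` ?A" using q(3) unfolding t_def by (intro image_eqI)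
  qed
qed

section \<open>Coordinates, distances and heights in dimensions 2 and 3\<close>

lemma vec2_eq_iff: "x = y \<longleftrightarrow> x $ 1 = y $ 1 \<and> x $ 2 = y $ 2" for x y :: "'a ^ 2"
  by (simp add: vec_eq_iff forall_2)

lemma vec3_eq_iff: "x = y \<longleftrightarrow> x $ 1 = y $ 1 \<and> x $ 2 = y $ 2 \<and> x $ 3 = y $ 3" for x y :: "'a ^ 3"
  by (simp add: vec_eq_iff forall_3)

lemma dist_vec2: "dist x y = sqrt ((x $ 1 - y $ 1)\<^sup>2 + (x $ 2 - y $ 2)\<^sup>2)" for x y :: "real ^ 2"
  by (simp add: dist_norm norm_vec_def L2_set_def sum_2)

lemma dist_vec3:
  "dist x y = sqrt ((x $ 1 - y $ 1)\<^sup>2 + (x $ 2 - y $ 2)\<^sup>2 + (x $ 3 - y $ 3)\<^sup>2)" for x y :: "real ^ 3"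
  by (simp add: dist_norm norm_vec_def L2_set_def sum_3)

lemma circle_height_vec2:
  assumes "q \<noteq> 0" "coprime a b"
  shows "circle_height (vector [of_int a / of_int q, of_int b / of_int q] :: real ^ 2) = \<bar>of_int q\<bar>"
proof -
  let ?p = "vector [a, b] :: int ^ 2"
  have "primitive ?p"
    using assms by (simp add: primitive_def UNIV_2)
  have "(vector [of_int a / of_int q, of_int b / of_int q] :: real ^ 2) = (\<chi> i. of_int (?p $ i) / of_int q)"
    by (simp add: vec2_eq_iff)
  then show ?thesis using circle_height_eq[OF assms(1) \<open>primitive ?p\<close>] by simp
qed

lemma circle_height_vec3:
  assumes "q \<noteq> 0" "gcd a (gcd b c) = 1"
  shows "circle_height (vector [of_int a / of_int q, of_int b / of_int q, of_int c / of_int q] :: real ^ 3)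
    = \<bar>of_int q\<bar>"
proof -
  let ?p = "vector [a, b, c] :: int ^ 3"
  have "primitive ?p"
    using assms by (simp add: primitive_def UNIV_3)
  have "(vector [of_int a / of_int q, of_int b / of_int q, of_int c / of_int q] :: real ^ 3) =
    (\<chi> i. of_int (?p $ i) / of_int q)"
    by (simp add: vec3_eq_iff)
  then show ?thesis using circle_height_eq[OF assms(1) \<open>primitive ?p\<close>] by simp
qed

section \<open>The unit circle\<close>

definition form_I :: "real \<Rightarrow> real" where
  "form_I u = 1 - 2 * u + 2 * u\<^sup>2"

text \<open>The Pythagorean parametrization: \<open>form_I u\<close> is the norm
  \<open>(1 - u)\<^sup>2 + u\<^sup>2\<close> of the Gaussian number with parts \<open>1 - u\<close>
  and \<open>u\<close>, and the point is the square of that number divided by its norm.\<close>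

definition param_I :: "real \<Rightarrow> real ^ 2" where
  "param_I u = vector [(1 - 2 * u) / form_I u, 2 * u * (1 - u) / form_I u]"

lemma form_I_ge: "1 / 2 \<le> form_I u"
proof -
  have "form_I u = 1 / 2 + 2 * (u - 1 / 2)\<^sup>2"
    by (simp add: form_I_def power2_eq_square algebra_simps)
  then show ?thesis by simp
qed

lemma form_I_pos: "0 < form_I u"
  using form_I_ge[of u] by linarith

lemma fraction_diff_square:
  fixes a b p q :: real
  assumes "p \<noteq> 0" "q \<noteq> 0"
  shows "(a / p - b / q)\<^sup>2 * (p * q)\<^sup>2 = (a * q - b * p)\<^sup>2"
  using assms by (simp add: diff_frac_eq power_divide)

text \<open>Recovers a distance from its square \<open>r\<close> after the denominators have been
  cleared, so that only a polynomial identity remains to be checked.\<close>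

lemma sqrt_divide_eq:
  assumes "0 < d" "0 \<le> c" "r * d\<^sup>2 = (c * x)\<^sup>2 * d"
  shows "sqrt r = c * \<bar>x\<bar> / sqrt d"
proof -
  have "r = (c * x)\<^sup>2 / d"
    using assms by (simp add: power2_eq_square field_simps)
  then show ?thesis
    using assms(2) by (simp add: real_sqrt_divide abs_mult)
qed

text \<open>Squaring doubles arguments, so the chord is twice the sine of the angle between the
  vectors \<open>(1 - s, s)\<close> and \<open>(1 - u, u)\<close>, whose determinant is
  \<open>u - s\<close>. The proof verifies this by clearing denominators.\<close>

lemma dist_param_I: "dist (param_I s) (param_I u) = 2 * \<bar>s - u\<bar> / (sqrt (form_I s) * sqrt (form_I u))"
proof -
  let ?d = "form_I s * form_I u"
  let ?r = "((1 - 2 * s) / form_I s - (1 - 2 * u) / form_I u)\<^sup>2 +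
    (2 * s * (1 - s) / form_I s - 2 * u * (1 - u) / form_I u)\<^sup>2"
  have "?r * ?d\<^sup>2 = ((1 - 2 * s) * form_I u - (1 - 2 * u) * form_I s)\<^sup>2 +
      (2 * s * (1 - s) * form_I u - 2 * u * (1 - u) * form_I s)\<^sup>2"
    using form_I_pos[of s] form_I_pos[of u] by (simp add: distrib_right fraction_diff_square)
  also have "\<dots> = (2 * (s - u))\<^sup>2 * ?d"
    unfolding form_I_def by algebra
  finally have "sqrt ?r = 2 * \<bar>s - u\<bar> / sqrt ?d"
    using form_I_pos by (intro sqrt_divide_eq) auto
  then show ?thesis
    by (simp add: dist_vec2 param_I_def real_sqrt_mult)
qed

lemma param_I_in: "param_I u \<in> circle_I"
proof -
  have "(1 - 2 * u)\<^sup>2 + (2 * u * (1 - u))\<^sup>2 = (form_I u)\<^sup>2"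
    unfolding form_I_def by algebra
  then show ?thesis
    using form_I_pos[of u]
    by (simp add: circle_I_def param_I_def power_divide flip: add_divide_distrib)
qed

text \<open>Stereographic projection from the rational point \<open>(0, -1)\<close>.\<close>

definition coord_I :: "real ^ 2 \<Rightarrow> real" where
  "coord_I x = (1 - x $ 1 / (1 + x $ 2)) / 2"

lemma coord_param_I: "coord_I (param_I u) = u"
proof -
  have "1 + 2 * u * (1 - u) / form_I u = 1 / form_I u"
    using form_I_pos[of u] by (simp add: field_simps form_I_def power2_eq_square)
  then show ?thesis
    using form_I_pos[of u] by (simp add: coord_I_def param_I_def)
qed

lemma param_coord_I:
  assumes "x \<in> circle_I" "x \<noteq> vector [0, -1]"
  shows "param_I (coord_I x) = x"
proof -
  have x: "(x $ 1)\<^sup>2 + (x $ 2)\<^sup>2 = 1" using assms by (simp add: circle_I_def)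
  have "1 + x $ 2 \<noteq> 0"
  proof
    assume "1 + x $ 2 = 0"
    then have "x $ 2 = -1" by simp
    with x assms(2) show False by (simp add: vec2_eq_iff)
  qed
  \<comment> \<open>With height measured from the centre of projection, the circle equation becomes
    \<open>(x $ 1)\<^sup>2 + v\<^sup>2 = 2 * v\<close>, whence
    \<open>form_I (coord_I x) = 1 / v\<close>.\<close>
  define v where "v = 1 + x $ 2"
  have v: "v \<noteq> 0" "x $ 2 = v - 1" "(x $ 1)\<^sup>2 = 2 * v - v\<^sup>2"
    using \<open>1 + x $ 2 \<noteq> 0\<close> x by (simp_all add: v_def power2_eq_square algebra_simps)
  have u: "coord_I x = (v - x $ 1) / (2 * v)"
    using v by (simp add: coord_I_def field_simps)
  have "form_I (coord_I x) * (2 * v\<^sup>2) = v\<^sup>2 + (x $ 1)\<^sup>2"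
    using v(1) by (simp add: u form_I_def field_simps power2_eq_square)
  then have "form_I (coord_I x) = 1 / v"
    using v by (simp add: field_simps power2_eq_square)
  moreover have "2 * coord_I x * (1 - coord_I x) * (2 * v\<^sup>2) = v\<^sup>2 - (x $ 1)\<^sup>2"
    using v(1) by (simp add: u field_simps power2_eq_square)
  then have "(2 * v) * (2 * coord_I x * (1 - coord_I x) * v) = (2 * v) * (v - 1)"
    unfolding v(3) by (simp add: power2_eq_square algebra_simps)
  then have "2 * coord_I x * (1 - coord_I x) * v = v - 1"
    using v(1) by (simp only: mult_cancel_left) simp
  moreover have "(1 - 2 * coord_I x) * v = x $ 1"
    using v(1) by (simp add: u field_simps)
  ultimately show ?thesis
    by (simp add: vec2_eq_iff param_I_def v(2))
qed

lemma circle_I_eq: "circle_I = insert (vector [0, -1]) (range param_I)"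
proof
  show "circle_I \<subseteq> insert (vector [0, -1]) (range param_I)"
  proof
    fix x assume "x \<in> circle_I"
    then show "x \<in> insert (vector [0, -1]) (range param_I)"
      using param_coord_I[of x] by (metis insert_iff rangeI)
  qed
  show "insert (vector [0, -1]) (range param_I) \<subseteq> circle_I"
    using param_I_in by (auto simp: circle_I_def)
qed

lemma inj_param_I: "inj param_I"
  using coord_param_I by (rule inj_on_inverseI)

text \<open>Both \<open>param_I\<close> and its inverse \<open>coord_I\<close> are rational
  functions with rational coefficients.\<close>

lemma param_I_rational_iff: "param_I u \<in> rational_points \<longleftrightarrow> u \<in> \<rat>"
proof
  assume "param_I u \<in> rational_points"
  then have "coord_I (param_I u) \<in> \<rat>"
    by (simp add: rational_points_def coord_I_def)
  then show "u \<in> \<rat>" by (simp add: coord_param_I)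
next
  assume "u \<in> \<rat>"
  then show "param_I u \<in> rational_points"
    by (simp add: rational_points_def forall_2 param_I_def form_I_def)
qed

text \<open>A common divisor of \<open>x\<close> and \<open>y\<close> divides both combinations. In
  each use the coefficients are chosen so that the combinations give back a pair known to be
  coprime.\<close>

lemma coprime_combination:
  fixes x y :: int
  assumes "coprime (i * x + j * y) (k * x + l * y)"
  shows "coprime x y"
proof (rule coprimeI)
  fix d assume "d dvd x" "d dvd y"
  then show "is_unit d"
    using assms by (intro coprime_common_divisor[OF assms]) simp_all
qed

text \<open>
  For \<open>u = m / n\<close> in lowest terms, the numerators \<open>n (n - 2 m)\<close> and \<open>2 m (n - m)\<close> of \<open>param_I u\<close>
  are coprime if \<open>n\<close> is odd and have greatest common divisor \<open>2\<close> otherwise.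
\<close>

lemma param_I_fraction:
  assumes "u \<in> \<rat>"
  obtains a b q :: int where "q > 0" "coprime a b" "odd a \<longleftrightarrow> even b"
    "param_I u = vector [of_int a / of_int q, of_int b / of_int q]"
    "of_int q = sqrt2_rat_height (sqrt 2 * u) * form_I u"
proof -
  obtain m n :: int where u: "n > 0" "coprime m n" "u = of_int m / of_int n"
    using assms by (rule Rats_cases')
  have form: "form_I u * (of_int n)\<^sup>2 = of_int (n\<^sup>2 - 2 * m * n + 2 * m\<^sup>2)"
    using u(1) by (simp add: form_I_def u(3) field_simps power2_eq_square)
  have pos: "0 < sqrt2_rat_height (sqrt 2 * u) * form_I u"
    using assms form_I_pos[of u] sqrt2_rat_height_ge_1[of "sqrt 2 * u"]
    by (intro mult_pos_pos) (auto simp: sqrt2_rats_def)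
  have num: "(1 - 2 * u) * (of_int n)\<^sup>2 = of_int (n * (n - 2 * m))"
    "2 * u * (1 - u) * (of_int n)\<^sup>2 = of_int (2 * m * (n - m))"
    using u(1) by (simp_all add: u(3) field_simps power2_eq_square)
  \<comment> \<open>\<open>k\<close> is the factor cancelled from numerators and denominator: 1 for
    odd \<open>n\<close>, 2 for even \<open>n\<close>.\<close>
  have param: "param_I u = vector [of_int a / of_int q, of_int b / of_int q]"
    if "k > 0" "n * (n - 2 * m) = k * a" "2 * m * (n - m) = k * b"
      "n\<^sup>2 - 2 * m * n + 2 * m\<^sup>2 = k * q" for a b q k :: int
  proof -
    have "(1 - 2 * u) / form_I u = ((1 - 2 * u) * (of_int n)\<^sup>2) / (form_I u * (of_int n)\<^sup>2)"
      "2 * u * (1 - u) / form_I u = (2 * u * (1 - u) * (of_int n)\<^sup>2) / (form_I u * (of_int n)\<^sup>2)"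
      using u(1) by simp_all
    then show ?thesis
      unfolding param_I_def num form that using that(1) by simp
  qed
  have ht: "sqrt2_rat_height (sqrt 2 * u) = (if odd n then (of_int n)\<^sup>2 else (of_int n)\<^sup>2 / 2)"
    unfolding u(3) by (rule sqrt2_rat_height_eq) (use u in auto)
  have "coprime n m" using u(2) by (simp add: coprime_commute)
  moreover have "coprime n (n - m)"
    using u(2) by (intro coprime_combination[of 1 n "-1" "n - m" 1 0]) simp
  moreover have "coprime m (n - m)"
    using u(2) by (intro coprime_combination[of 1 m 0 "n - m" 1 1]) simp
  ultimately have cop: "coprime n m" "coprime n (n - m)" "coprime m (n - m)" .
  show thesis
  proof (cases "odd n")
    case True
    have "coprime (n - 2 * m) m"
      using u(2) by (intro coprime_combination[of 0 "n - 2 * m" 1 m 1 2]) simp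
    moreover have "coprime (n - 2 * m) (n - m)"
      using u(2) by (intro coprime_combination[of "-1" "n - 2 * m" 1 "n - m" "-1" 2]) simp
    ultimately have "coprime (n * (n - 2 * m)) (2 * m * (n - m))"
      using True cop by simp
    moreover have "odd (n * (n - 2 * m)) \<longleftrightarrow> even (2 * m * (n - m))" using True by simp
    moreover have "of_int (n\<^sup>2 - 2 * m * n + 2 * m\<^sup>2) = sqrt2_rat_height (sqrt 2 * u) * form_I u"
      unfolding ht form[symmetric] using True by simp
    moreover from this have "n\<^sup>2 - 2 * m * n + 2 * m\<^sup>2 > 0"
      using pos by (metis of_int_0_less_iff)
    ultimately show ?thesis
      by (intro that[OF _ _ _ param[of 1 _ _ "n\<^sup>2 - 2 * m * n + 2 * m\<^sup>2"]]) (assumption | simp)+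
  next
    case False
    then obtain k where k: "n = 2 * k" by blast
    have "odd m" "coprime m k" using u(2) k by auto
    have "coprime k (2 * k - m)"
      using \<open>coprime m k\<close> by (intro coprime_combination[of 2 k "-1" "2 * k - m" 1 0]) simp
    moreover have "coprime (k - m) m"
      using \<open>coprime m k\<close> by (intro coprime_combination[of 0 "k - m" 1 m 1 1]) simp
    moreover have "coprime (k - m) (2 * k - m)"
      using \<open>coprime m k\<close> by (intro coprime_combination[of "-2" "k - m" 1 "2 * k - m" "-1" 1]) simp
    ultimately have "coprime (2 * k * (k - m)) (m * (2 * k - m))"
      using \<open>odd m\<close> \<open>coprime m k\<close> by (simp add: coprime_commute)
    moreover have "odd (2 * k * (k - m)) \<longleftrightarrow> even (m * (2 * k - m))" using \<open>odd m\<close> by simp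
    \<comment> \<open>Cancelling 2 halves the denominator
      \<open>form_I u * (of_int n)\<^sup>2\<close>, exactly as \<open>sqrt2_rat_height\<close>
      halves the square of an even \<open>n\<close>.\<close>
    moreover have "of_int (2 * k\<^sup>2 - 2 * m * k + m\<^sup>2) = sqrt2_rat_height (sqrt 2 * u) * form_I u"
    proof -
      have "of_int (2 * (2 * k\<^sup>2 - 2 * m * k + m\<^sup>2)) = form_I u * (of_int n)\<^sup>2"
        unfolding form by (simp add: k power2_eq_square algebra_simps)
      then show ?thesis unfolding ht using False by (simp add: mult.commute)
    qed
    moreover from this have "2 * k\<^sup>2 - 2 * m * k + m\<^sup>2 > 0"
      using pos by (metis of_int_0_less_iff)
    ultimately show ?thesis
      by (intro that[OF _ _ _ param[of 2 _ _ "2 * k\<^sup>2 - 2 * m * k + m\<^sup>2"]])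
        (assumption | simp add: k power2_eq_square algebra_simps)+
  qed
qed

lemma circle_height_param_I:
  assumes "u \<in> \<rat>"
  shows "circle_height (param_I u) = sqrt2_rat_height (sqrt 2 * u) * form_I u"
proof -
  obtain a b q :: int where q: "q > 0" "coprime a b"
    "param_I u = vector [of_int a / of_int q, of_int b / of_int q]"
    "of_int q = sqrt2_rat_height (sqrt 2 * u) * form_I u"
    using assms by (rule param_I_fraction)
  then show ?thesis using circle_height_vec2[of q a b] by simp
qed

lemma sqrt2_rats_iff: "z \<in> sqrt2_rats \<longleftrightarrow> z / sqrt 2 \<in> \<rat>"
  by (auto simp: sqrt2_rats_def intro: exI[of _ "z / sqrt 2"])

lemma range_divide_sqrt2: "range (\<lambda>z. f (z / sqrt 2)) = range f"
proof -
  have "f u \<in> range (\<lambda>z. f (z / sqrt 2))" for u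
    by (rule image_eqI[of _ _ "sqrt 2 * u"]) simp_all
  then show ?thesis by auto
qed

lemma inj_divide_sqrt2: "inj f \<Longrightarrow> inj (\<lambda>z. f (z / sqrt 2))"
  by (rule injI) (simp add: inj_eq)

lemma continuous_on_form_I: "continuous_on UNIV (\<lambda>z. sqrt (form_I (z / sqrt 2)))"
  unfolding form_I_def by (intro continuous_intros) auto

lemma sqrt_form_I_ge: "sqrt (1 / 2) \<le> sqrt (form_I u)"
  using form_I_ge by simp

text \<open>The coordinate on the line is \<open>z = sqrt 2 * u\<close>, so that rational
  \<open>u\<close> correspond to \<open>sqrt2_rats\<close>; this rescaling turns the constant 2 of
  \<open>dist_param_I\<close> into \<open>2 / sqrt 2 = sqrt 2\<close>.\<close>

theorem lagrange_spectrum_circle_I: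
  "lagrange_spectrum circle_I (circle_I \<inter> rational_points) circle_height =
    (\<lambda>L. ennreal (1 / sqrt 2) * L) ` lagrange_spectrum UNIV sqrt2_rats sqrt2_rat_height"
proof (rule lagrange_spectrum_param[where f = "\<lambda>z. param_I (z / sqrt 2)"
      and w = "\<lambda>z. sqrt (form_I (z / sqrt 2))" and m = "sqrt (1 / 2)" and p = "vector [0, -1]"])
  show "circle_I = insert (vector [0, -1]) (range (\<lambda>z. param_I (z / sqrt 2)))"
    unfolding range_divide_sqrt2 by (rule circle_I_eq)
  show "(vector [0, -1] :: real ^ 2) \<in> rational_points"
    by (simp add: rational_points_def forall_2)
  show "dist (param_I (s / sqrt 2)) (param_I (u / sqrt 2)) =
      sqrt 2 * \<bar>s - u\<bar> / (sqrt (form_I (s / sqrt 2)) * sqrt (form_I (u / sqrt 2)))" for s u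
  proof -
    have "2 * \<bar>s / sqrt 2 - u / sqrt 2\<bar> = 2 / sqrt 2 * \<bar>s - u\<bar>"
      by (simp add: abs_divide flip: diff_divide_distrib)
    also have "2 / sqrt 2 = sqrt (2 :: real)" by (rule real_div_sqrt) simp
    finally have "2 * \<bar>s / sqrt 2 - u / sqrt 2\<bar> = sqrt 2 * \<bar>s - u\<bar>" .
    then show ?thesis by (simp add: dist_param_I)
  qed
  show "circle_height (param_I (z / sqrt 2)) = sqrt2_rat_height z * (sqrt (form_I (z / sqrt 2)))\<^sup>2"
    if "z \<in> sqrt2_rats" for z
    using that form_I_pos[of "z / sqrt 2"]
    by (simp add: sqrt2_rats_iff circle_height_param_I less_imp_le)
  show "sqrt (1 / 2) \<le> sqrt (form_I (u / sqrt 2))" for u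
    by (rule sqrt_form_I_ge)
qed (simp_all add: finite_sqrt2_rat_height sqrt2_rat_height_ge_1 inj_divide_sqrt2 inj_param_I
    param_I_rational_iff continuous_on_form_I flip: sqrt2_rats_iff)

section \<open>The circle of squared radius 2\<close>

text \<open>The second circle is the first one multiplied by the complex number \<open>1 + i\<close>.\<close>

definition spiral :: "real ^ 2 \<Rightarrow> real ^ 2" where
  "spiral x = vector [x $ 1 - x $ 2, x $ 1 + x $ 2]"

lemma inj_spiral: "inj spiral"
  by (rule injI) (simp add: spiral_def vec2_eq_iff)

lemma dist_spiral: "dist (spiral x) (spiral y) = sqrt 2 * dist x y"
proof -
  have "(x $ 1 - x $ 2 - (y $ 1 - y $ 2))\<^sup>2 + (x $ 1 + x $ 2 - (y $ 1 + y $ 2))\<^sup>2 =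
    2 * ((x $ 1 - y $ 1)\<^sup>2 + (x $ 2 - y $ 2)\<^sup>2)"
    by algebra
  then show ?thesis by (simp only: dist_vec2 spiral_def vector_2 real_sqrt_mult)
qed

lemma spiral_rational_iff: "spiral x \<in> rational_points \<longleftrightarrow> x \<in> rational_points"
proof
  assume "spiral x \<in> rational_points"
  then have r: "x $ 1 - x $ 2 \<in> \<rat>" "x $ 1 + x $ 2 \<in> \<rat>"
    by (auto simp: rational_points_def spiral_def forall_2)
  have "x $ 1 = ((x $ 1 - x $ 2) + (x $ 1 + x $ 2)) / 2" by simp
  then have "x $ 1 \<in> \<rat>" by (metis r Rats_add Rats_divide Rats_number_of)
  moreover from this have "x $ 2 \<in> \<rat>" using Rats_diff[OF r(2)] by fastforce
  ultimately show "x \<in> rational_points" by (simp add: rational_points_def forall_2)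
qed (simp add: rational_points_def spiral_def forall_2)

lemma circle_II_eq: "circle_II = spiral ` circle_I"
proof
  show "circle_II \<subseteq> spiral ` circle_I"
  proof
    fix y assume y: "y \<in> circle_II"
    \<comment> \<open>Multiplication by the complex number \<open>(1 - i) / 2\<close>, the inverse
      of \<open>1 + i\<close>.\<close>
    let ?x = "vector [(y $ 1 + y $ 2) / 2, (y $ 2 - y $ 1) / 2] :: real ^ 2"
    have "((y $ 1 + y $ 2) / 2)\<^sup>2 + ((y $ 2 - y $ 1) / 2)\<^sup>2 = ((y $ 1)\<^sup>2 + (y $ 2)\<^sup>2) / 2"
      by (simp add: power2_eq_square field_simps)
    then have "?x \<in> circle_I" using y by (simp add: circle_I_def circle_II_def)
    moreover have "y = spiral ?x" by (simp add: spiral_def vec2_eq_iff field_simps)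
    ultimately show "y \<in> spiral ` circle_I" by blast
  qed
  show "spiral ` circle_I \<subseteq> circle_II"
    by (auto simp: circle_I_def circle_II_def spiral_def power2_eq_square algebra_simps)
qed

text \<open>Multiplying by \<open>1 + i\<close> causes no cancellation: a common divisor of
  \<open>a - b\<close> and \<open>a + b\<close> divides \<open>2 * a\<close> and
  \<open>2 * b\<close>, and it is odd because \<open>a\<close> and \<open>b\<close> have opposite
  parity. So the denominator \<open>q\<close> is unchanged.\<close>

lemma circle_height_spiral_param_I:
  assumes "u \<in> \<rat>"
  shows "circle_height (spiral (param_I u)) = sqrt2_rat_height (sqrt 2 * u) * form_I u"
proof -
  obtain a b q :: int where q: "q > 0" "coprime a b" "odd a \<longleftrightarrow> even b"
    "param_I u = vector [of_int a / of_int q, of_int b / of_int q]"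
    "of_int q = sqrt2_rat_height (sqrt 2 * u) * form_I u"
    using assms by (rule param_I_fraction)
  have "coprime (a - b) (a + b)"
  proof (rule coprimeI)
    fix d assume d: "d dvd a - b" "d dvd a + b"
    then have "d dvd (a - b) + (a + b)" "d dvd (a + b) - (a - b)"
      by (blast intro: dvd_add dvd_diff)+
    then have "d dvd 2 * a" "d dvd 2 * b" by simp_all
    moreover have "coprime 2 (a - b)" using q(3) by auto
    then have "coprime d 2" using d(1) by (meson coprime_commute coprime_divisors dvd_refl)
    ultimately have "d dvd a" "d dvd b" by (simp_all add: coprime_dvd_mult_right_iff)
    then show "is_unit d" by (rule coprime_common_divisor[OF q(2)])
  qed
  moreover have "spiral (param_I u) = vector [of_int (a - b) / of_int q, of_int (a + b) / of_int q]"
    by (simp add: q(4) spiral_def diff_divide_distrib add_divide_distrib)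
  ultimately show ?thesis
    using q circle_height_vec2[of q "a - b" "a + b"] by simp
qed

text \<open>Compared with the unit circle, distances grow by \<open>sqrt 2\<close> while heights
  stay the same, so the constant rises from \<open>sqrt 2\<close> to 2.\<close>

theorem lagrange_spectrum_circle_II:
  "lagrange_spectrum circle_II (circle_II \<inter> rational_points) circle_height =
    (\<lambda>L. ennreal (1 / 2) * L) ` lagrange_spectrum UNIV sqrt2_rats sqrt2_rat_height"
proof (rule lagrange_spectrum_param[where f = "\<lambda>z. spiral (param_I (z / sqrt 2))"
      and w = "\<lambda>z. sqrt (form_I (z / sqrt 2))" and m = "sqrt (1 / 2)" and p = "spiral (vector [0, -1])"])
  have "range (\<lambda>z. spiral (param_I (z / sqrt 2))) = spiral ` range param_I"
    using range_divide_sqrt2[of "\<lambda>u. spiral (param_I u)"] by (simp add: image_image)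
  then show "circle_II = insert (spiral (vector [0, -1])) (range (\<lambda>z. spiral (param_I (z / sqrt 2))))"
    by (simp add: circle_II_eq circle_I_eq)
  show "inj (\<lambda>z. spiral (param_I (z / sqrt 2)))"
    using inj_spiral inj_param_I by (intro inj_divide_sqrt2) (simp add: inj_def)
  show "spiral (vector [0, -1]) \<in> rational_points"
    by (simp add: rational_points_def forall_2 spiral_def)
  show "dist (spiral (param_I (s / sqrt 2))) (spiral (param_I (u / sqrt 2))) =
      2 * \<bar>s - u\<bar> / (sqrt (form_I (s / sqrt 2)) * sqrt (form_I (u / sqrt 2)))" for s u
  proof -
    have "sqrt 2 * (2 * \<bar>s / sqrt 2 - u / sqrt 2\<bar>) = 2 * \<bar>s - u\<bar>"
      by (simp add: abs_divide flip: diff_divide_distrib)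
    then show ?thesis by (simp add: dist_param_I dist_spiral)
  qed
  show "circle_height (spiral (param_I (z / sqrt 2))) = sqrt2_rat_height z * (sqrt (form_I (z / sqrt 2)))\<^sup>2"
    if "z \<in> sqrt2_rats" for z
    using that form_I_pos[of "z / sqrt 2"]
    by (simp add: sqrt2_rats_iff circle_height_spiral_param_I less_imp_le)
  show "sqrt (1 / 2) \<le> sqrt (form_I (u / sqrt 2))" for u
    by (rule sqrt_form_I_ge)
qed (simp_all add: finite_sqrt2_rat_height sqrt2_rat_height_ge_1 spiral_rational_iff
    param_I_rational_iff continuous_on_form_I flip: sqrt2_rats_iff)

section \<open>The circle in three-dimensional space\<close>

definition form_III :: "real \<Rightarrow> real" where
  "form_III u = u\<^sup>2 + u + 1"

text \<open>On the plane with coordinate sum 1, the unit sphere is where the pairwise products of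
  coordinates sum to 0. Here \<open>u\<close> is the ratio of the first coordinate to the second,
  when the latter is nonzero, and \<open>form_III\<close> is the norm form of the Eisenstein
  integers.\<close>

definition param_III :: "real \<Rightarrow> real ^ 3" where
  "param_III u = vector [u * (u + 1) / form_III u, (u + 1) / form_III u, - u / form_III u]"

lemma form_III_ge: "3 / 4 \<le> form_III u"
proof -
  have "form_III u = 3 / 4 + (u + 1 / 2)\<^sup>2"
    by (simp add: form_III_def power2_eq_square algebra_simps)
  then show ?thesis by simp
qed

lemma form_III_pos: "0 < form_III u"
  using form_III_ge[of u] by linarith

lemma dist_param_III:
  "dist (param_III s) (param_III u) = sqrt 2 * \<bar>s - u\<bar> / (sqrt (form_III s) * sqrt (form_III u))"
proof -
  let ?d = "form_III s * form_III u"
  let ?r = "(s * (s + 1) / form_III s - u * (u + 1) / form_III u)\<^sup>2 +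
    ((s + 1) / form_III s - (u + 1) / form_III u)\<^sup>2 + (- s / form_III s - - u / form_III u)\<^sup>2"
  have "?r * ?d\<^sup>2 = (s * (s + 1) * form_III u - u * (u + 1) * form_III s)\<^sup>2 +
      ((s + 1) * form_III u - (u + 1) * form_III s)\<^sup>2 + (- s * form_III u - - u * form_III s)\<^sup>2"
    using form_III_pos[of s] form_III_pos[of u]
    by (simp only: distrib_right fraction_diff_square less_imp_neq[symmetric] not_False_eq_True)
  also have "\<dots> = 2 * (s - u)\<^sup>2 * ?d"
    unfolding form_III_def by algebra
  \<comment> \<open>The rational constant 2 of the polynomial identity is rewritten as the square of
    \<open>sqrt 2\<close> to fit \<open>sqrt_divide_eq\<close>.\<close>
  finally have "?r * ?d\<^sup>2 = (sqrt 2 * (s - u))\<^sup>2 * ?d"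
    by (simp only: power_mult_distrib) simp
  then have "sqrt ?r = sqrt 2 * \<bar>s - u\<bar> / sqrt ?d"
    using form_III_pos by (intro sqrt_divide_eq) auto
  then show ?thesis
    by (simp add: dist_vec3 param_III_def real_sqrt_mult)
qed

lemma param_III_in: "param_III u \<in> circle_III"
proof -
  have "u * (u + 1) + (u + 1) - u = form_III u"
    "(u * (u + 1))\<^sup>2 + (u + 1)\<^sup>2 + u\<^sup>2 = (form_III u)\<^sup>2"
    unfolding form_III_def by algebra+
  then show ?thesis
    using form_III_pos[of u]
    by (simp add: circle_III_def param_III_def power_divide
        flip: add_divide_distrib diff_divide_distrib)
qed

text \<open>Stereographic projection from the rational point \<open>(1, 0, 0)\<close>.\<close>

definition coord_III :: "real ^ 3 \<Rightarrow> real" where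
  "coord_III x = - x $ 3 / (x $ 2 + x $ 3)"

lemma coord_param_III: "coord_III (param_III u) = u"
  using form_III_pos[of u] by (simp add: coord_III_def param_III_def flip: add_divide_distrib diff_divide_distrib)

lemma param_coord_III:
  assumes "x \<in> circle_III" "x \<noteq> vector [1, 0, 0]"
  shows "param_III (coord_III x) = x"
proof -
  have x: "x $ 1 = 1 - (x $ 2 + x $ 3)" "(x $ 1)\<^sup>2 + (x $ 2)\<^sup>2 + (x $ 3)\<^sup>2 = 1"
    using assms by (auto simp: circle_III_def)
  define v where "v = x $ 2 + x $ 3"
  have "v \<noteq> 0"
  proof
    assume "v = 0"
    then have "x $ 1 = 1" "(x $ 2)\<^sup>2 + (x $ 3)\<^sup>2 = 0" using x by (simp_all add: v_def)
    with assms(2) show False by (simp add: vec3_eq_iff)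
  qed
  have v: "x $ 1 = 1 - v" "x $ 2 = v - x $ 3" using x(1) by (simp_all add: v_def)
  \<comment> \<open>This is the vanishing of the sum of pairwise products, written in
    \<open>v\<close> and \<open>x $ 3\<close>; its left side is
    \<open>form_III (coord_III x) * v\<^sup>2\<close>.\<close>
  have quad: "(x $ 3)\<^sup>2 - x $ 3 * v + v\<^sup>2 = v"
    using x(2) unfolding v by (simp add: power2_eq_square algebra_simps)
  have u: "coord_III x = - x $ 3 / v" by (simp add: coord_III_def v_def)
  have "form_III (coord_III x) * v\<^sup>2 = (x $ 3)\<^sup>2 - x $ 3 * v + v\<^sup>2"
    using \<open>v \<noteq> 0\<close> by (simp add: u form_III_def field_simps power2_eq_square)
  then have "form_III (coord_III x) = 1 / v"
    unfolding quad using \<open>v \<noteq> 0\<close> by (simp add: field_simps power2_eq_square)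
  moreover have "coord_III x * (coord_III x + 1) * v = 1 - v"
  proof -
    have "coord_III x * (coord_III x + 1) * v * v = (x $ 3)\<^sup>2 - x $ 3 * v"
      using \<open>v \<noteq> 0\<close> by (simp add: u field_simps power2_eq_square)
    also have "\<dots> = (1 - v) * v" using quad by (simp add: power2_eq_square algebra_simps)
    finally show ?thesis using \<open>v \<noteq> 0\<close> by simp
  qed
  moreover have "(coord_III x + 1) * v = x $ 2" "- coord_III x * v = x $ 3"
    using \<open>v \<noteq> 0\<close> by (simp_all add: u field_simps v_def)
  ultimately show ?thesis
    by (simp add: vec3_eq_iff param_III_def v(1))
qed

lemma circle_III_eq: "circle_III = insert (vector [1, 0, 0]) (range param_III)"
proof
  show "circle_III \<subseteq> insert (vector [1, 0, 0]) (range param_III)"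
  proof
    fix x assume "x \<in> circle_III"
    then show "x \<in> insert (vector [1, 0, 0]) (range param_III)"
      using param_coord_III[of x] by (metis insert_iff rangeI)
  qed
  show "insert (vector [1, 0, 0]) (range param_III) \<subseteq> circle_III"
    using param_III_in by (auto simp: circle_III_def)
qed

lemma inj_param_III: "inj param_III"
  using coord_param_III by (rule inj_on_inverseI)

lemma param_III_rational_iff: "param_III u \<in> rational_points \<longleftrightarrow> u \<in> \<rat>"
proof
  assume "param_III u \<in> rational_points"
  then have "coord_III (param_III u) \<in> \<rat>"
    by (simp add: rational_points_def coord_III_def)
  then show "u \<in> \<rat>" by (simp add: coord_param_III)
next
  assume "u \<in> \<rat>"
  then show "param_III u \<in> rational_points"
    by (simp add: rational_points_def forall_3 param_III_def form_III_def)
qed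

text \<open>For \<open>u = m / n\<close> in lowest terms the numerators never share a factor: the
  first two have greatest common divisor \<open>\<bar>m + n\<bar>\<close>, and \<open>m + n\<close>
  is coprime to \<open>m * n\<close>. Hence the denominator is
  \<open>n\<^sup>2 * form_III u\<close>, whatever the parity of \<open>n\<close>.\<close>

lemma circle_height_param_III:
  assumes "u \<in> \<rat>"
  shows "circle_height (param_III u) = rat_height u * form_III u"
proof -
  obtain m n :: int where u: "n > 0" "coprime m n" "u = of_int m / of_int n"
    using assms by (rule Rats_cases')
  define q where "q = m\<^sup>2 + m * n + n\<^sup>2"
  have form: "form_III u * (of_int n)\<^sup>2 = of_int q"
    using u(1) by (simp add: q_def form_III_def u(3) field_simps power2_eq_square)
  have "0 < form_III u * (of_int n)\<^sup>2" using u(1) form_III_pos[of u] by simp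
  then have "q > 0" unfolding form by simp
  have num: "u * (u + 1) * (of_int n)\<^sup>2 = of_int (m * (m + n))"
    "(u + 1) * (of_int n)\<^sup>2 = of_int (n * (m + n))" "- u * (of_int n)\<^sup>2 = of_int (- (m * n))"
    using u(1) by (simp_all add: u(3) field_simps power2_eq_square)
  have cancel: "x / form_III u = x * (of_int n)\<^sup>2 / (form_III u * (of_int n)\<^sup>2)" for x
    using u(1) by simp
  have "param_III u = vector [of_int (m * (m + n)) / of_int q, of_int (n * (m + n)) / of_int q,
      of_int (- (m * n)) / of_int q]"
    unfolding param_III_def cancel[of "u * (u + 1)"] cancel[of "u + 1"] cancel[of "- u"] num form ..
  moreover have "gcd (m * (m + n)) (gcd (n * (m + n)) (- (m * n))) = 1"
  proof -
    have "gcd (m * (m + n)) (n * (m + n)) = \<bar>m + n\<bar>"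
      using u(2) by (simp add: gcd_mult_right coprime_iff_gcd_eq_1 mult.commute[of _ "m + n"] gcd_mult_left)
    moreover have "coprime (m + n) m" "coprime (m + n) n"
      using u(2) by (auto intro: coprime_combination[of 0 "m + n" 1 m 1 "-1"]
          coprime_combination[of 1 "m + n" "-1" n 0 1])
    ultimately show ?thesis
      by (simp flip: gcd.assoc)
  qed
  ultimately have "circle_height (param_III u) = of_int q"
    using \<open>q > 0\<close> circle_height_vec3[of q "m * (m + n)" "n * (m + n)" "- (m * n)"] by simp
  also have "\<dots> = rat_height u * form_III u"
    using u rat_height_eq[of n m] by (simp flip: form)
  finally show ?thesis .
qed

text \<open>The parameter itself serves as coordinate on the line, since its height already matches;
  \<open>c\<close> is the \<open>sqrt 2\<close> of \<open>dist_param_III\<close>.\<close>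

theorem lagrange_spectrum_circle_III:
  "lagrange_spectrum circle_III (circle_III \<inter> rational_points) circle_height =
    (\<lambda>L. ennreal (1 / sqrt 2) * L) ` lagrange_spectrum UNIV \<rat> rat_height"
proof (rule lagrange_spectrum_param[where f = param_III
      and w = "\<lambda>z. sqrt (form_III z)" and m = "sqrt (3 / 4)" and p = "vector [1, 0, 0]"])
  show "(vector [1, 0, 0] :: real ^ 3) \<in> rational_points"
    by (simp add: rational_points_def forall_3)
  show "circle_height (param_III z) = rat_height z * (sqrt (form_III z))\<^sup>2" if "z \<in> \<rat>" for z
    using that form_III_pos[of z] by (simp add: circle_height_param_III less_imp_le)
  show "continuous_on UNIV (\<lambda>z. sqrt (form_III z))"
    unfolding form_III_def by (intro continuous_intros)
  show "sqrt (3 / 4) \<le> sqrt (form_III u)" for u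
    using form_III_ge by (simp only: real_sqrt_le_iff)
qed (simp_all add: finite_rat_height rat_height_ge_1 circle_III_eq inj_param_III
    param_III_rational_iff dist_param_III)

theorem corollary1p2:
  shows "lagrange_spectrum circle_I (circle_I \<inter> rational_points) circle_height =
           (\<lambda>L. ennreal (1 / sqrt 2) * L) ` lagrange_spectrum UNIV sqrt2_rats sqrt2_rat_height
       \<and> lagrange_spectrum circle_II (circle_II \<inter> rational_points) circle_height =
           (\<lambda>L. ennreal (1 / 2) * L) ` lagrange_spectrum UNIV sqrt2_rats sqrt2_rat_height
       \<and> lagrange_spectrum circle_III (circle_III \<inter> rational_points) circle_height =
           (\<lambda>L. ennreal (1 / sqrt 2) * L) ` lagrange_spectrum UNIV \<rat> rat_height"
  using lagrange_spectrum_circle_I lagrange_spectrum_circle_II lagrange_spectrum_circle_III by blast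

end
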